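(* Let $S$ be a finite set, let $\Gamma$ be the Coxeter graph of a Coxeter matrix over $S$, and let $SA=SA_\Gamma$ be the associated singular Artin monoid. Then $SA$ embeds in a group, i.e. there exist a group $H$ and an injective monoid homomorphism $SA\to H$.
   Context: A Coxeter matrix over a finite set $S$ is a matrix $(m_{s\,t})_{s,t\in S}$ with $m_{s\,s}=1$ for all $s$ and $m_{s\,t}=m_{t\,s}\in\{2,3,4,\dots,+\infty\}$ for $s\ne t$; it is encoded by its Coxeter graph $\Gamma$. For letters $a,b$ and an integer $m\ge 1$, $w(m:a,b)$ denotes the alternating word $\cdots bab$ of length $m$ ending in $b$. The singular Artin monoid $SA=SA_\Gamma$ is the monoid generated by $\{\sigma_s,\sigma_s^{-1},\tau_s; s\in S\}$ with relations: $\sigma_s\sigma_s^{-1}=\sigma_s^{-1}\sigma_s=1$ and $\sigma_s\tau_s=\tau_s\sigma_s$ for $s\in S$; for $s\ne t$ with $m_{s\,t}<+\infty$, $w(m_{s\,t}:\sigma_s,\sigma_t)=w(m_{s\,t}:\sigma_t,\sigma_s)$ and $w(m_{s\,t}-1:\sigma_s,\sigma_t)\,\tau_s=\tau_{s\wedge t}\,w(m_{s\,t}-1:\sigma_s,\sigma_t)$, where $s\wedge t=s$ if $m_{s\,t}$ is even and $s\wedge t=t$ if $m_{s\,t}$ is odd; and $\tau_s\tau_t=\tau_t\tau_s$ for $s\neq t$ with $m_{s\,t}=2$. *)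

theory Defs
  imports "HOL-Algebra.Group" "HOL-Library.Extended_Nat"
begin

section \<open>Monoids given by generators and relations\<close>

inductive_set word_cong :: "'a set \<Rightarrow> ('a list \<times> 'a list) set \<Rightarrow> ('a list \<times> 'a list) set"
  for X :: "'a set" and R :: "('a list \<times> 'a list) set"
where
  rel: "\<lbrakk>(u, v) \<in> R; u \<in> lists X; v \<in> lists X; a \<in> lists X; b \<in> lists X\<rbrakk>
        \<Longrightarrow> (a @ u @ b, a @ v @ b) \<in> word_cong X R"
| refl: "w \<in> lists X \<Longrightarrow> (w, w) \<in> word_cong X R"
| sym: "(u, v) \<in> word_cong X R \<Longrightarrow> (v, u) \<in> word_cong X R"
| trans: "\<lbrakk>(u, v) \<in> word_cong X R; (v, w) \<in> word_cong X R\<rbrakk> \<Longrightarrow> (u, w) \<in> word_cong X R"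

definition presented_monoid :: "'a set \<Rightarrow> ('a list \<times> 'a list) set \<Rightarrow> 'a list set monoid"
where
  "presented_monoid X R =
     \<lparr>carrier = lists X // word_cong X R,
      mult = (\<lambda>A B. \<Union>u\<in>A. \<Union>v\<in>B. word_cong X R `` {u @ v}),
      one = word_cong X R `` {[]}\<rparr>"

lemma word_cong_in_lists:
  assumes "(u, v) \<in> word_cong X R"
  shows "u \<in> lists X \<and> v \<in> lists X"
  using assms by induction auto

lemma equiv_word_cong: "equiv (lists X) (word_cong X R)"
  by (rule equivI)
     (auto simp: refl_on_def sym_def trans_def
           dest: word_cong_in_lists intro: word_cong.refl word_cong.sym word_cong.trans)

lemma word_cong_context:
  assumes "(u, v) \<in> word_cong X R" "a \<in> lists X" "b \<in> lists X"
  shows "(a @ u @ b, a @ v @ b) \<in> word_cong X R"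
  using assms
proof induction
  case (rel u v c d)
  have "((a @ c) @ u @ (d @ b), (a @ c) @ v @ (d @ b)) \<in> word_cong X R"
    using rel by (intro word_cong.rel) auto
  then show ?case by simp
next
  case (refl w)
  then show ?case by (intro word_cong.refl) auto
qed (blast intro: word_cong.sym word_cong.trans)+

lemma congruent2_append:
  "congruent2 (word_cong X R) (word_cong X R) (\<lambda>u v. word_cong X R `` {u @ v})"
proof (rule congruent2I')
  fix u u' v v'
  assume a: "(u, u') \<in> word_cong X R" and b: "(v, v') \<in> word_cong X R"
  have "(u @ v, u' @ v) \<in> word_cong X R"
    using word_cong_context[OF a, of "[]" v] word_cong_in_lists[OF b] by simp
  moreover have "(u' @ v, u' @ v') \<in> word_cong X R"
    using word_cong_context[OF b, of u' "[]"] word_cong_in_lists[OF a] by simp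
  ultimately show "word_cong X R `` {u @ v} = word_cong X R `` {u' @ v'}"
    by (intro equiv_class_eq[OF equiv_word_cong]) (rule word_cong.trans)
qed

lemma presented_monoid_mult_class:
  assumes "u \<in> lists X" "v \<in> lists X"
  shows "word_cong X R `` {u} \<otimes>\<^bsub>presented_monoid X R\<^esub> word_cong X R `` {v}
           = word_cong X R `` {u @ v}"
  using UN_equiv_class2[OF equiv_word_cong equiv_word_cong congruent2_append assms]
  by (simp add: presented_monoid_def)

lemma monoid_presented_monoid: "monoid (presented_monoid X R)"
proof -
  let ?M = "presented_monoid X R"
  have car: "\<exists>u\<in>lists X. A = word_cong X R `` {u}" if "A \<in> carrier ?M" for A
    using that by (auto simp: presented_monoid_def elim!: quotientE)
  have cls: "word_cong X R `` {u} \<in> carrier ?M" if "u \<in> lists X" for u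
    using that by (simp add: presented_monoid_def quotientI)
  have one: "\<one>\<^bsub>?M\<^esub> = word_cong X R `` {[]}"
    by (simp add: presented_monoid_def)
  note m = presented_monoid_mult_class
  show ?thesis
  proof (rule monoidI)
    fix A B assume "A \<in> carrier ?M" "B \<in> carrier ?M"
    then obtain u v where "u \<in> lists X" "v \<in> lists X"
      "A = word_cong X R `` {u}" "B = word_cong X R `` {v}"
      by (metis car)
    then show "A \<otimes>\<^bsub>?M\<^esub> B \<in> carrier ?M"
      by (simp only: m) (rule cls, simp)
  next
    show "\<one>\<^bsub>?M\<^esub> \<in> carrier ?M" unfolding one by (rule cls) simp
  next
    fix A B C assume "A \<in> carrier ?M" "B \<in> carrier ?M" "C \<in> carrier ?M"
    then obtain u v w where *: "u \<in> lists X" "v \<in> lists X" "w \<in> lists X"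
      "A = word_cong X R `` {u}" "B = word_cong X R `` {v}" "C = word_cong X R `` {w}"
      by (metis car)
    then have "u @ v \<in> lists X" "v @ w \<in> lists X" by auto
    with * show "A \<otimes>\<^bsub>?M\<^esub> B \<otimes>\<^bsub>?M\<^esub> C = A \<otimes>\<^bsub>?M\<^esub> (B \<otimes>\<^bsub>?M\<^esub> C)"
      by (simp only: m append_assoc)
  next
    fix A assume "A \<in> carrier ?M"
    then obtain u where *: "u \<in> lists X" "A = word_cong X R `` {u}" by (metis car)
    have nil: "[] \<in> lists X" by simp
    from * nil show "\<one>\<^bsub>?M\<^esub> \<otimes>\<^bsub>?M\<^esub> A = A"
      by (simp only: one m append_Nil)
    from * nil show "A \<otimes>\<^bsub>?M\<^esub> \<one>\<^bsub>?M\<^esub> = A"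
      by (simp only: one m append_Nil2)
  qed
qed

section \<open>Coxeter matrices and singular Artin monoids\<close>

definition coxeter_matrix :: "'s set \<Rightarrow> ('s \<Rightarrow> 's \<Rightarrow> enat) \<Rightarrow> bool" where
  "coxeter_matrix S m \<longleftrightarrow>
     (\<forall>s\<in>S. m s s = 1) \<and>
     (\<forall>s\<in>S. \<forall>t\<in>S. s \<noteq> t \<longrightarrow> m s t = m t s \<and> 2 \<le> m s t)"

text \<open>The alternating word \<open>\<dots> b a b\<close> of length \<open>n\<close>, with last letter \<open>b\<close>.\<close>

fun alt_word :: "nat \<Rightarrow> 'a \<Rightarrow> 'a \<Rightarrow> 'a list" where
  "alt_word 0 a b = []"
| "alt_word (Suc n) a b = alt_word n b a @ [b]"

datatype 's sgen = Sigma 's | SigmaInv 's | Tau 's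

definition sa_gens :: "'s set \<Rightarrow> 's sgen set" where
  "sa_gens S = Sigma ` S \<union> SigmaInv ` S \<union> Tau ` S"

text \<open>In \<open>tau_braid\<close> the conditional is the letter \<open>s \<and> t\<close>: \<open>s\<close> if \<open>m s t\<close> is even and \<open>t\<close> if it
  is odd.\<close>

inductive_set sa_rels :: "'s set \<Rightarrow> ('s \<Rightarrow> 's \<Rightarrow> enat) \<Rightarrow> ('s sgen list \<times> 's sgen list) set"
  for S :: "'s set" and m :: "'s \<Rightarrow> 's \<Rightarrow> enat"
where
  inv_right: "s \<in> S \<Longrightarrow> ([Sigma s, SigmaInv s], []) \<in> sa_rels S m"
| inv_left: "s \<in> S \<Longrightarrow> ([SigmaInv s, Sigma s], []) \<in> sa_rels S m"
| sigma_tau: "s \<in> S \<Longrightarrow> ([Sigma s, Tau s], [Tau s, Sigma s]) \<in> sa_rels S m"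
| braid: "\<lbrakk>s \<in> S; t \<in> S; s \<noteq> t; m s t = enat k\<rbrakk>
    \<Longrightarrow> (alt_word k (Sigma s) (Sigma t), alt_word k (Sigma t) (Sigma s)) \<in> sa_rels S m"
| tau_braid: "\<lbrakk>s \<in> S; t \<in> S; s \<noteq> t; m s t = enat k\<rbrakk>
    \<Longrightarrow> (alt_word (k - 1) (Sigma s) (Sigma t) @ [Tau s],
         [Tau (if even k then s else t)] @ alt_word (k - 1) (Sigma s) (Sigma t)) \<in> sa_rels S m"
| tau_tau: "\<lbrakk>s \<in> S; t \<in> S; s \<noteq> t; m s t = 2\<rbrakk>
    \<Longrightarrow> ([Tau s, Tau t], [Tau t, Tau s]) \<in> sa_rels S m"

definition singular_artin_monoid ::
  "'s set \<Rightarrow> ('s \<Rightarrow> 's \<Rightarrow> enat) \<Rightarrow> 's sgen list set monoid" where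
  "singular_artin_monoid S m = presented_monoid (sa_gens S) (sa_rels S m)"

text \<open>A monoid \<open>M\<close> generated by \<open>X\<close> that embeds in some group also embeds in a group that is generated
  by the image of \<open>X\<close>, hence in a quotient of the free monoid on two copies of \<open>X\<close> (the generators
  and their formal inverses). The elements of that quotient are sets of words over
  \<open>'x \<times> bool\<close>. HOL cannot quantify existentially over types, and this type for the elements of the
  group is therefore no restriction when \<open>M\<close> is given by generators of type \<open>'x\<close>.\<close>

definition embeds_in_group :: "'x list set monoid \<Rightarrow> bool" where
  "embeds_in_group M \<longleftrightarrow>
     (\<exists>H :: ('x \<times> bool) list set monoid. group H \<and>
        (\<exists>h. h \<in> hom M H \<and> h \<one>\<^bsub>M\<^esub> = \<one>\<^bsub>H\<^esub> \<and> inj_on h (carrier M)))"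

end

(* Every element of the monoid M generated by units sigma and letters tau is a product of conjugates
   g tau g^-1 followed by a unit; the unit is recovered from a word by deleting the letters tau. So
   M embeds in a group as soon as a product of conjugates can be recovered from a permutation
   action that is compatible with conjugation. For every pair (u, v) of elements that are equal or do
   not commute, let u act on the rationals by q -> 2 q and v by q -> 2 q + 1 (only by q -> 2 q if
   u = v), and let all other elements act trivially. The two maps generate a free monoid, and a list
   of elements is determined, up to exchanging commuting neighbours, by its images under all these
   actions: this is the projection argument for the word problem in trace monoids. *)
theory Submission
  imports Defs "HOL-Algebra.Bij" "HOL-Algebra.Weak_Morphisms"
begin

section \<open>Products of lists and presented monoids\<close>

context monoid
begin

definition list_prod :: "'a list \<Rightarrow> 'a" where
  "list_prod l = foldr (\<otimes>) l \<one>"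

lemma list_prod_Nil [simp]: "list_prod [] = \<one>"
  by (simp add: list_prod_def)

lemma list_prod_Cons [simp]: "list_prod (x # l) = x \<otimes> list_prod l"
  by (simp add: list_prod_def)

lemma list_prod_closed [simp, intro]: "set l \<subseteq> carrier G \<Longrightarrow> list_prod l \<in> carrier G"
  by (induction l) auto

lemma list_prod_append:
  "set k \<subseteq> carrier G \<Longrightarrow> set l \<subseteq> carrier G \<Longrightarrow> list_prod (k @ l) = list_prod k \<otimes> list_prod l"
  by (induction k) (auto simp: m_assoc)

lemma list_prod_word_cong:
  assumes "(u, v) \<in> word_cong X R" and \<phi>: "\<phi> \<in> X \<rightarrow> carrier G"
    and R: "\<And>u v. (u, v) \<in> R \<Longrightarrow> u \<in> lists X \<Longrightarrow> v \<in> lists X \<Longrightarrow>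
      list_prod (map \<phi> u) = list_prod (map \<phi> v)"
  shows "list_prod (map \<phi> u) = list_prod (map \<phi> v)"
  using assms(1)
proof induction
  case (rel u v a b)
  have cl: "set (map \<phi> w) \<subseteq> carrier G" if "w \<in> lists X" for w
    using that \<phi> by auto
  have "list_prod (map \<phi> (a @ u @ b))
      = list_prod (map \<phi> a) \<otimes> (list_prod (map \<phi> u) \<otimes> list_prod (map \<phi> b))"
    using cl[of a] cl[of u] cl[of b] rel by (simp add: list_prod_append)
  moreover have "list_prod (map \<phi> (a @ v @ b))
      = list_prod (map \<phi> a) \<otimes> (list_prod (map \<phi> v) \<otimes> list_prod (map \<phi> b))"
    using cl[of a] cl[of v] cl[of b] rel by (simp add: list_prod_append)
  ultimately show ?case using R rel by simp
qed auto

end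

section \<open>Signed words and the embedding criterion\<close>

lemma (in group) list_prod_signed_inverse:
  assumes "\<phi> \<in> X \<rightarrow> carrier G" and "w \<in> lists (X \<times> UNIV)"
  defines "\<psi> \<equiv> \<lambda>(x, b). if b then \<phi> x else inv (\<phi> x)"
  shows "list_prod (map \<psi> (rev (map (\<lambda>(x, b). (x, \<not> b)) w))) = inv (list_prod (map \<psi> w))"
  using assms(2)
proof (induction w)
  case (Cons p w)
  obtain x b where p: "p = (x, b)" by force
  have cl: "\<psi> y \<in> carrier G" if "fst y \<in> X" for y
    using that assms(1) by (auto simp: \<psi>_def split: prod.split)
  have w: "w \<in> lists (X \<times> UNIV)" and x: "x \<in> X" using Cons.hyps p by auto
  have 1: "set (map \<psi> (rev (map (\<lambda>(x, b). (x, \<not> b)) w))) \<subseteq> carrier G"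
    and 2: "set (map \<psi> w) \<subseteq> carrier G"
    using w by (auto intro!: cl split: prod.splits)
  have 3: "\<psi> (x, \<not> b) = inv (\<psi> (x, b))" using x funcset_mem[OF assms(1)] by (auto simp: \<psi>_def)
  show ?case
    using cl[of "(x, b)"] x 1 2 Cons.IH
    by (simp add: p list_prod_append 3 inv_mult_group)
qed simp

text \<open>The group \<open>G\<close> may have any element type, while
  \<open>embeds_in_group\<close> asks for sets of signed words. So \<open>G\<close> is cut down to
  the subgroup \<open>K\<close> of values of signed words, and each element of \<open>K\<close> is
  replaced by the set of signed words with that value.\<close>

lemma embeds_in_groupI:
  fixes G (structure) and \<phi> :: "'x \<Rightarrow> 'g"
  assumes "group G" and \<phi>: "\<phi> \<in> X \<rightarrow> carrier G"
    and cong: "\<And>u v. u \<in> lists X \<Longrightarrow> v \<in> lists X \<Longrightarrow> (u, v) \<in> word_cong X R \<longleftrightarrow>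
      monoid.list_prod G (map \<phi> u) = monoid.list_prod G (map \<phi> v)"
  shows "embeds_in_group (presented_monoid X R)"
proof -
  interpret group G by fact
  let ?M = "presented_monoid X R"
  define \<psi> where "\<psi> = (\<lambda>(x, b). if b then \<phi> x else inv (\<phi> x))"
  define W where "W = lists (X \<times> (UNIV :: bool set))"
  define K where "K = (\<lambda>w. list_prod (map \<psi> w)) ` W"
  have \<psi>: "set (map \<psi> w) \<subseteq> carrier G" if "w \<in> W" for w
  proof -
    have "\<psi> p \<in> carrier G" if "p \<in> X \<times> UNIV" for p
      using that funcset_mem[OF \<phi>] by (auto simp: \<psi>_def)
    then show ?thesis using that by (auto simp: W_def in_lists_conv_set)
  qed
  have "subgroup K G"
  proof
    show "K \<subseteq> carrier G" using \<psi> by (auto simp: K_def)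
    show "\<one> \<in> K" unfolding K_def W_def by (rule image_eqI[of _ _ "[]"]) auto
    fix x assume "x \<in> K"
    then obtain u where u: "u \<in> W" "x = list_prod (map \<psi> u)" by (auto simp: K_def)
    have "rev (map (\<lambda>(x, b). (x, \<not> b)) u) \<in> W" using u(1) by (auto simp: W_def)
    moreover have "inv x = list_prod (map \<psi> (rev (map (\<lambda>(x, b). (x, \<not> b)) u)))"
      using list_prod_signed_inverse[OF \<phi>] u by (simp add: W_def \<psi>_def)
    ultimately show "inv x \<in> K" by (auto simp: K_def)
    fix y assume "y \<in> K"
    then obtain v where v: "v \<in> W" "y = list_prod (map \<psi> v)" by (auto simp: K_def)
    have "x \<otimes> y = list_prod (map \<psi> (u @ v))"
      using \<psi>[OF u(1)] \<psi>[OF v(1)] u v by (simp add: list_prod_append)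
    moreover have "u @ v \<in> W" using u v by (auto simp: W_def)
    ultimately show "x \<otimes> y \<in> K" unfolding K_def by (rule image_eqI)
  qed
  then interpret K: group "G\<lparr>carrier := K\<rparr>" by (rule subgroup_imp_group)
  \<comment> \<open>The fibres of evaluation over \<open>K\<close> are nonempty and pairwise
    disjoint, so \<open>f\<close> is injective on \<open>K\<close> and transports its group
    structure to the required type.\<close>
  define f where "f g = {w \<in> W. list_prod (map \<psi> w) = g}" for g
  have inj: "inj_on f K"
    by (rule inj_onI) (auto simp: K_def f_def set_eq_iff)
  define H where "H = image_group f (G\<lparr>carrier := K\<rparr>)"
  have H: "group H" and iso: "f \<in> iso (G\<lparr>carrier := K\<rparr>) H"
    unfolding H_def using inj K.inj_imp_image_group_is_group[of f]
      inj_imp_image_group_iso[of f "G\<lparr>carrier := K\<rparr>"] by auto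
  define val where "val A = list_prod (map \<phi> (SOME w. w \<in> A))" for A
  have val: "val (word_cong X R `` {w}) = list_prod (map \<phi> w)" if "w \<in> lists X" for w
  proof -
    have "(SOME v. v \<in> word_cong X R `` {w}) \<in> word_cong X R `` {w}"
      by (rule someI[of _ w]) (simp add: word_cong.refl that)
    then show ?thesis unfolding val_def using cong that word_cong_in_lists by (metis Image_singleton_iff)
  qed
  have car: "\<exists>w\<in>lists X. A = word_cong X R `` {w}" if "A \<in> carrier ?M" for A
    using that by (auto simp: presented_monoid_def elim!: quotientE)
  have valK: "list_prod (map \<phi> w) \<in> K" if "w \<in> lists X" for w
  proof -
    have "list_prod (map \<phi> w) = list_prod (map \<psi> (map (\<lambda>x. (x, True)) w))"
      by (simp add: \<psi>_def comp_def)
    moreover have "map (\<lambda>x. (x, True)) w \<in> W" using that by (auto simp: W_def)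
    ultimately show ?thesis unfolding K_def by (rule image_eqI)
  qed
  have cl: "set (map \<phi> w) \<subseteq> carrier G" if "w \<in> lists X" for w
    using that \<phi> by auto
  have hom: "val \<in> hom ?M (G\<lparr>carrier := K\<rparr>)"
  proof (rule homI)
    fix A assume "A \<in> carrier ?M"
    then show "val A \<in> carrier (G\<lparr>carrier := K\<rparr>)" using car val valK by fastforce
    fix B assume "B \<in> carrier ?M"
    with \<open>A \<in> carrier ?M\<close> obtain u v where
      *: "u \<in> lists X" "v \<in> lists X" "A = word_cong X R `` {u}" "B = word_cong X R `` {v}"
      using car by meson
    have "u @ v \<in> lists X" using * by auto
    then show "val (A \<otimes>\<^bsub>?M\<^esub> B) = val A \<otimes>\<^bsub>G\<lparr>carrier := K\<rparr>\<^esub> val B"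
      using * cl[of u] cl[of v] by (simp only: presented_monoid_mult_class val)
        (simp add: list_prod_append)
  qed
  have "inj_on val (carrier ?M)"
  proof (rule inj_onI)
    fix A B assume "A \<in> carrier ?M" "B \<in> carrier ?M" and eq: "val A = val B"
    then obtain u v where
      *: "u \<in> lists X" "v \<in> lists X" "A = word_cong X R `` {u}" "B = word_cong X R `` {v}"
      using car by meson
    then have "(u, v) \<in> word_cong X R" using eq cong by (simp add: val)
    with * show "A = B" by (metis equiv_class_eq equiv_word_cong)
  qed
  moreover have "val ` carrier ?M \<subseteq> K" using hom by (auto simp: hom_def)
  ultimately have "inj_on (f \<circ> val) (carrier ?M)"
    using inj by (meson comp_inj_on inj_on_subset)
  moreover have "f \<circ> val \<in> hom ?M H"
    using hom iso by (auto simp: iso_def intro: Group.hom_compose)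
  moreover have "(f \<circ> val) \<one>\<^bsub>?M\<^esub> = \<one>\<^bsub>H\<^esub>"
    using val[of "[]"] by (simp add: presented_monoid_def H_def image_group_one)
  ultimately show ?thesis using H unfolding embeds_in_group_def by blast
qed

section \<open>Recovering a product of list elements from rational dilations\<close>

context monoid
begin

text \<open>Over the rationals both dilations are invertible; at integers their values have opposite
  parity, which tells \<open>u\<close> and \<open>v\<close> apart. Distinct commuting pairs are
  switched off so that commuting elements act by commuting maps; diagonal pairs stay active and
  count occurrences.\<close>

definition dil :: "'a \<Rightarrow> 'a \<Rightarrow> 'a \<Rightarrow> rat \<Rightarrow> rat" where
  "dil t u v q =
     (if u \<noteq> v \<and> u \<otimes> v = v \<otimes> u then q
      else if t = u then 2 * q else if t = v then 2 * q + 1 else q)"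

definition dils :: "'a list \<Rightarrow> 'a \<Rightarrow> 'a \<Rightarrow> rat \<Rightarrow> rat" where
  "dils l u v = foldr (\<lambda>t. dil t u v) l"

lemma dils_Nil [simp]: "dils [] u v q = q"
  by (simp add: dils_def)

lemma dils_Cons [simp]: "dils (t # l) u v q = dil t u v (dils l u v q)"
  by (simp add: dils_def)

lemma dils_append [simp]: "dils (k @ l) u v q = dils k u v (dils l u v q)"
  by (simp add: dils_def)

text \<open>If \<open>t\<close> and \<open>x\<close> are the two distinct members of the pair, the
  first branch of \<open>dil\<close> makes both maps the identity. Otherwise the two maps are equal
  or one of them is the identity.\<close>

lemma dil_commute:
  "t \<otimes> x = x \<otimes> t \<Longrightarrow> dil t u v (dil x u v q) = dil x u v (dil t u v q)"
  by (auto simp: dil_def)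

lemma dils_commute:
  "(\<And>x. x \<in> set l \<Longrightarrow> t \<otimes> x = x \<otimes> t) \<Longrightarrow> dils l u v (dil t u v q) = dil t u v (dils l u v q)"
  by (induction l) (auto simp: dil_commute)

lemma bij_dil: "bij (dil t u v)"
proof (rule bijI)
  show "inj (dil t u v)" by (rule injI) (auto simp: dil_def split: if_splits)
  have "dil t u v (if u \<noteq> v \<and> u \<otimes> v = v \<otimes> u then r
      else if t = u then r / 2 else if t = v then (r - 1) / 2 else r) = r" for r
    by (simp add: dil_def diff_divide_distrib)
  then show "surj (dil t u v)" by (rule surjI)
qed

lemma bij_dils: "bij (dils l u v)"
proof (induction l)
  case Nil
  then show ?case by (simp add: dils_def bij_id[unfolded id_def] id_def)
next
  case (Cons t l)
  then show ?case using bij_comp[OF Cons bij_dil[of t u v]] by (simp add: dils_def comp_def)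
qed

text \<open>Every occurrence of \<open>t\<close> doubles and all other letters act trivially, so
  evaluation at \<open>1\<close> detects whether \<open>t\<close> occurs.\<close>

lemma dils_diagonal: "dils l t t q = 2 ^ count_list l t * q"
  by (induction l) (auto simp: dil_def)

lemma two_power_count_eq_one_iff: "(2 :: rat) ^ count_list l t = 1 \<longleftrightarrow> t \<notin> set l"
proof
  assume "(2 :: rat) ^ count_list l t = 1"
  then have "\<not> 0 < count_list l t" using one_less_power[of "2 :: rat" "count_list l t"] by auto
  then show "t \<notin> set l" by (metis count_list_0_iff neq0_conv)
next
  assume "t \<notin> set l"
  then have "count_list l t = 0" by (metis count_list_0_iff)
  then show "(2 :: rat) ^ count_list l t = 1" by (simp only: power_0)
qed

lemma dil_Ints: "q \<in> \<int> \<Longrightarrow> dil t u v q \<in> \<int>"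
  by (auto simp: dil_def)

lemma dils_Ints: "q \<in> \<int> \<Longrightarrow> dils l u v q \<in> \<int>"
  by (induction l) (auto intro: dil_Ints)

lemma double_neq_double_plus_one:
  fixes a b :: rat
  assumes "a \<in> \<int>" "b \<in> \<int>"
  shows "2 * a \<noteq> 2 * b + 1"
proof
  assume "2 * a = 2 * b + 1"
  moreover obtain i j where "a = of_int i" "b = of_int j" using assms by (auto elim!: Ints_cases)
  ultimately have "of_int (2 * i) = (of_int (2 * j + 1) :: rat)" by simp
  then have "2 * i = 2 * j + 1" by (simp only: of_int_eq_iff)
  then show False by presburger
qed

text \<open>The head of a list acts last. Since \<open>t\<close> is absent, every letter before the
  first \<open>x\<close> acts trivially, and that \<open>x\<close> makes an integer value
  odd.\<close>

lemma dils_mem_double_plus_one: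
  assumes "x \<in> set l" "t \<notin> set l" "x \<otimes> t \<noteq> t \<otimes> x" "q \<in> \<int>"
  shows "\<exists>r\<in>\<int>. dils l t x q = 2 * r + 1"
  using assms(1,2)
proof (induction l)
  case (Cons y l)
  show ?case
  proof (cases "y = x")
    case True
    then have "dils (y # l) t x q = 2 * dils l t x q + 1"
      using assms Cons.prems by (auto simp: dil_def)
    then show ?thesis using dils_Ints[OF assms(4)] by blast
  next
    case False
    then have "dils (y # l) t x q = dils l t x q"
      using Cons.prems by (auto simp: dil_def)
    then show ?thesis using Cons False by auto
  qed
qed simp

lemma list_prod_commute:
  assumes "set l \<subseteq> carrier G" "t \<in> carrier G" "\<And>x. x \<in> set l \<Longrightarrow> x \<otimes> t = t \<otimes> x"
  shows "list_prod l \<otimes> t = t \<otimes> list_prod l"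
  using assms
proof (induction l)
  case (Cons x l)
  have "list_prod l \<otimes> t = t \<otimes> list_prod l" using Cons by simp
  then have "x \<otimes> list_prod l \<otimes> t = x \<otimes> t \<otimes> list_prod l"
    using Cons.prems(1,2) by (simp add: m_assoc)
  also have "x \<otimes> t = t \<otimes> x" using Cons.prems by simp
  finally show ?case using Cons.prems by (simp add: m_assoc)
qed simp

text \<open>Induction on \<open>k\<close>: its head \<open>t\<close> occurs in \<open>l\<close> by
  the diagonal pair, and everything before its first occurrence there commutes with
  \<open>t\<close>. Hence \<open>t\<close> can be moved to the front of \<open>l\<close> without
  changing the product, and its injective action cancelled.\<close>

lemma list_prod_eq_if_dils_eq:
  assumes "set k \<subseteq> carrier G" "set l \<subseteq> carrier G"
    and "\<And>u v q. u \<in> carrier G \<Longrightarrow> v \<in> carrier G \<Longrightarrow> dils k u v q = dils l u v q"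
  shows "list_prod k = list_prod l"
  using assms
proof (induction k arbitrary: l)
  case Nil
  have "t \<notin> set l" for t
  proof
    assume t: "t \<in> set l"
    have "2 ^ count_list l t = (1 :: rat)"
      using Nil(3)[of t t 1] t Nil(2) by (auto simp: dils_diagonal)
    then show False using t two_power_count_eq_one_iff[of l t] by blast
  qed
  then show ?case by (cases l) auto
next
  case (Cons t k)
  note eq = Cons.prems(3)
  have t: "t \<in> carrier G" using Cons.prems by simp
  have "(2 :: rat) ^ count_list (t # k) t = 2 ^ count_list l t"
    using eq[OF t t, of 1] by (simp only: dils_diagonal mult_1_right)
  then have "t \<in> set l" by (metis list.set_intros(1) two_power_count_eq_one_iff)
  then obtain a b where l: "l = a @ t # b" and a: "t \<notin> set a"
    by (meson split_list_first)
  have ab: "set a \<subseteq> carrier G" "set b \<subseteq> carrier G" using Cons.prems l by auto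
  have comm: "x \<otimes> t = t \<otimes> x" if x: "x \<in> set a" for x
  proof (rule ccontr)
    assume n: "x \<otimes> t \<noteq> t \<otimes> x"
    \<comment> \<open>At the integer \<open>0\<close> the pair \<open>(t, x)\<close> gives an even
      value for \<open>t # k\<close> but an odd one for \<open>l\<close>, where \<open>x\<close>
      precedes the first \<open>t\<close>.\<close>
    have "dils (t # k) t x 0 = 2 * dils k t x 0" using n by (simp add: dil_def)
    moreover obtain r where "r \<in> \<int>" "dils l t x 0 = 2 * r + 1"
      using dils_mem_double_plus_one[OF x a n, of "dils (t # b) t x 0"] dils_Ints[of 0]
      unfolding l by (metis Ints_0 dils_append)
    ultimately show False
      using eq[of t x 0] t x ab double_neq_double_plus_one[OF dils_Ints[OF Ints_0]] by auto
  qed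
  have "list_prod k = list_prod (a @ b)"
  proof (rule Cons.IH)
    fix u v q assume uv: "u \<in> carrier G" "v \<in> carrier G"
    have "dil t u v (dils k u v q) = dils a u v (dil t u v (dils b u v q))"
      using eq[OF uv, of q] l by simp
    also have "\<dots> = dil t u v (dils (a @ b) u v q)"
      using dils_commute[of a t u v] comm by simp
    finally show "dils k u v q = dils (a @ b) u v q"
      using bij_dil[of t u v] by (metis bij_def injD)
  qed (use Cons.prems ab in auto)
  moreover have "list_prod l = t \<otimes> list_prod (a @ b)"
    using list_prod_commute[OF ab(1) t comm] t ab
    by (simp add: l list_prod_append flip: m_assoc)
  ultimately show ?case by simp
qed

section \<open>A permutation group containing pairs of a unit and a list of elements\<close>

definition conjugate :: "'a \<Rightarrow> 'a \<Rightarrow> 'a" where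
  "conjugate g x = g \<otimes> x \<otimes> inv g"

lemma conjugate_closed [simp, intro]: "g \<in> Units G \<Longrightarrow> x \<in> carrier G \<Longrightarrow> conjugate g x \<in> carrier G"
  by (simp add: conjugate_def Units_closed)

lemma conjugate_one [simp]: "x \<in> carrier G \<Longrightarrow> conjugate \<one> x = x"
  by (simp add: conjugate_def)

lemma inv_mult_Units:
  assumes "g \<in> Units G" "h \<in> Units G"
  shows "inv (g \<otimes> h) = inv h \<otimes> inv g"
proof (rule inv_char)
  have "g \<otimes> h \<otimes> (inv h \<otimes> inv g) = g \<otimes> (h \<otimes> inv h) \<otimes> inv g"
    using assms by (simp add: Units_closed m_assoc del: Units_r_inv)
  then show "g \<otimes> h \<otimes> (inv h \<otimes> inv g) = \<one>" using assms by (simp add: Units_closed)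
  have "inv h \<otimes> inv g \<otimes> (g \<otimes> h) = inv h \<otimes> (inv g \<otimes> g) \<otimes> h"
    using assms by (simp add: Units_closed m_assoc del: Units_l_inv)
  then show "inv h \<otimes> inv g \<otimes> (g \<otimes> h) = \<one>" using assms by (simp add: Units_closed)
qed (use assms in auto)

lemma conjugate_conj:
  "g \<in> Units G \<Longrightarrow> h \<in> Units G \<Longrightarrow> x \<in> carrier G \<Longrightarrow> conjugate g (conjugate h x) = conjugate (g \<otimes> h) x"
  by (simp add: conjugate_def inv_mult_Units Units_closed m_assoc)

lemma conjugate_inv_cancel [simp]:
  "g \<in> Units G \<Longrightarrow> x \<in> carrier G \<Longrightarrow> conjugate (inv g) (conjugate g x) = x"
  "g \<in> Units G \<Longrightarrow> x \<in> carrier G \<Longrightarrow> conjugate g (conjugate (inv g) x) = x"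
  by (simp_all add: conjugate_conj)

lemma conjugate_eq_iff:
  "g \<in> Units G \<Longrightarrow> x \<in> carrier G \<Longrightarrow> y \<in> carrier G \<Longrightarrow> conjugate g x = conjugate g y \<longleftrightarrow> x = y"
  by (metis conjugate_inv_cancel(1))

lemma conjugate_mult_right:
  assumes "g \<in> Units G" "x \<in> carrier G"
  shows "conjugate g x \<otimes> g = g \<otimes> x"
  using assms by (simp add: conjugate_def Units_closed m_assoc)

lemma conjugate_mult:
  assumes "g \<in> Units G" "x \<in> carrier G" "y \<in> carrier G"
  shows "conjugate g (x \<otimes> y) = conjugate g x \<otimes> conjugate g y"
proof -
  have "conjugate g x \<otimes> conjugate g y = conjugate g x \<otimes> g \<otimes> y \<otimes> inv g"
    using assms by (simp add: conjugate_def[of g y] Units_closed m_assoc)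
  also have "\<dots> = conjugate g (x \<otimes> y)"
    using assms by (simp only: conjugate_mult_right) (simp add: conjugate_def Units_closed m_assoc)
  finally show ?thesis by simp
qed

lemma list_prod_map_conj:
  "g \<in> Units G \<Longrightarrow> set l \<subseteq> carrier G \<Longrightarrow> list_prod (map (conjugate g) l) = conjugate g (list_prod l)"
  by (induction l) (auto simp: conjugate_mult, simp add: conjugate_def Units_closed)

text \<open>Conjugation by a unit is an automorphism of the monoid, and \<open>dil\<close> depends
  only on which of its arguments are equal and whether the pair commutes.\<close>

lemma dil_conj:
  assumes "g \<in> Units G" "t \<in> carrier G" "u \<in> carrier G" "v \<in> carrier G"
  shows "dil (conjugate g t) (conjugate g u) (conjugate g v) q = dil t u v q"
  using assms by (simp add: dil_def conjugate_eq_iff flip: conjugate_mult)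

lemma dils_conj:
  assumes "g \<in> Units G" "set l \<subseteq> carrier G" "u \<in> carrier G" "v \<in> carrier G"
  shows "dils (map (conjugate g) l) (conjugate g u) (conjugate g v) q = dils l u v q"
  using assms(2) by (induction l) (auto simp: dil_conj assms)

section \<open>Permutations encoding a unit and a list\<close>

definition points :: "('a \<times> 'a \<times> 'a \<times> rat) set" where
  "points = carrier G \<times> carrier G \<times> carrier G \<times> UNIV"

text \<open>The unit acts first and \<open>l\<close> then acts at the new pair, mirroring
  \<open>list_prod l \<otimes> g\<close>. Keeping all pairs in one set lets units permute them, and
  the coordinate \<open>c\<close> makes \<open>g\<close> visible. The restriction to
  \<open>points\<close> provides the extensionality demanded by \<open>Bij\<close>.\<close>

definition act :: "'a \<Rightarrow> 'a list \<Rightarrow> 'a \<times> 'a \<times> 'a \<times> rat \<Rightarrow> 'a \<times> 'a \<times> 'a \<times> rat" where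
  "act g l = (\<lambda>(c, u, v, q) \<in> points.
     (g \<otimes> c, conjugate g u, conjugate g v, dils l (conjugate g u) (conjugate g v) q))"

lemma act_apply:
  "c \<in> carrier G \<Longrightarrow> u \<in> carrier G \<Longrightarrow> v \<in> carrier G \<Longrightarrow>
   act g l (c, u, v, q) =
     (g \<otimes> c, conjugate g u, conjugate g v, dils l (conjugate g u) (conjugate g v) q)"
  by (simp add: act_def points_def)

lemma act_eqI:
  assumes "\<And>u v q. u \<in> carrier G \<Longrightarrow> v \<in> carrier G \<Longrightarrow>
    dils k (conjugate g u) (conjugate g v) q = dils l (conjugate g u) (conjugate g v) q"
  shows "act g k = act g l"
  unfolding act_def using assms by (intro restrict_ext) (auto simp: points_def)

lemma act_Bij:
  assumes g: "g \<in> Units G"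
  shows "act g l \<in> Bij points"
proof -
  define act' where "act' = (\<lambda>(c, u, v, q).
    (inv g \<otimes> c, conjugate (inv g) u, conjugate (inv g) v, the_inv (dils l u v) q))"
  have inj: "inj (dils l u v)" and surj: "range (dils l u v) = UNIV" for u v
    using bij_dils[of l u v] by (auto simp: bij_def)
  have "bij_betw (act g l) points points"
    by (rule bij_betw_byWitness[where f' = act'])
      (auto simp: points_def act_apply act'_def g Units_closed the_inv_f_f[OF inj]
        f_the_inv_into_f[OF inj] surj simp flip: m_assoc)
  then show ?thesis by (simp add: Bij_def act_def)
qed

text \<open>The multiplication law of a semidirect product: moving \<open>l\<close> past
  \<open>g\<close> conjugates its entries, by the equivariance in \<open>dils_conj\<close>.\<close>

lemma act_mult:
  assumes "g \<in> Units G" "h \<in> Units G" "set k \<subseteq> carrier G" "set l \<subseteq> carrier G"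
  shows "act g k \<otimes>\<^bsub>BijGroup points\<^esub> act h l = act (g \<otimes> h) (k @ map (conjugate g) l)"
proof -
  have "act g k \<otimes>\<^bsub>BijGroup points\<^esub> act h l = compose points (act g k) (act h l)"
    using assms by (simp add: BijGroup_def act_Bij)
  also have "\<dots> = act (g \<otimes> h) (k @ map (conjugate g) l)"
  proof (rule extensionalityI)
    fix p assume "p \<in> points"
    then obtain c u v q where p: "p = (c, u, v, q)" "c \<in> carrier G" "u \<in> carrier G" "v \<in> carrier G"
      by (auto simp: points_def)
    have "dils (map (conjugate g) l) (conjugate (g \<otimes> h) u) (conjugate (g \<otimes> h) v) q
        = dils l (conjugate h u) (conjugate h v) q"
      using dils_conj[OF assms(1,4), of "conjugate h u" "conjugate h v" q] assms p by (simp add: conjugate_conj)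
    then show "compose points (act g k) (act h l) p = act (g \<otimes> h) (k @ map (conjugate g) l) p"
      using \<open>p \<in> points\<close> p assms
      by (simp add: compose_def act_apply Units_closed conjugate_conj m_assoc)
  qed (auto simp: act_def)
  finally show ?thesis .
qed

lemma act_one: "act \<one> [] = \<one>\<^bsub>BijGroup points\<^esub>"
  unfolding BijGroup_def act_def by (auto simp: points_def intro!: restrict_ext)

lemma act_inject:
  assumes "act g k = act h l" "g \<in> Units G" "h \<in> Units G"
    and "set k \<subseteq> carrier G" "set l \<subseteq> carrier G"
  shows "g = h \<and> list_prod k = list_prod l"
proof
  have "act g k (\<one>, \<one>, \<one>, 0) = act h l (\<one>, \<one>, \<one>, 0)" using assms(1) by simp
  then show gh: "g = h" using assms(2,3) by (simp add: act_apply Units_closed)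
  show "list_prod k = list_prod l"
  proof (rule list_prod_eq_if_dils_eq)
    fix u v q assume "u \<in> carrier G" "v \<in> carrier G"
    \<comment> \<open>The pair is conjugated by \<open>inv g\<close> beforehand so that the
      dilations are evaluated at \<open>(u, v)\<close> itself.\<close>
    moreover have "act g k (\<one>, conjugate (inv g) u, conjugate (inv g) v, q)
        = act g l (\<one>, conjugate (inv g) u, conjugate (inv g) v, q)"
      using assms(1) gh by simp
    ultimately show "dils k u v q = dils l u v q"
      using assms(2) by (simp add: act_apply)
  qed (use assms in auto)
qed

end

section \<open>Presentations by units and elements permuted by conjugation\<close>

text \<open>Relations of these three shapes preserve the unit obtained by deleting the letters of
  \<open>T\<close>, and change the list of conjugates at most by swapping commuting
  neighbours.\<close>

locale conjugation_presentation =
  fixes Y T :: "'x set" and R :: "('x list \<times> 'x list) set"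
  assumes disjoint: "Y \<inter> T = {}"
    and units: "y \<in> Y \<Longrightarrow>
      word_cong (Y \<union> T) R `` {[y]} \<in> Units (presented_monoid (Y \<union> T) R)"
    and rels: "(u, v) \<in> R \<Longrightarrow> u \<in> lists Y \<and> v \<in> lists Y \<or>
      (\<exists>a\<in>lists Y. \<exists>t\<in>T. \<exists>t'\<in>T. u = a @ [t] \<and> v = t' # a) \<or>
      (\<exists>t\<in>T. \<exists>t'\<in>T. u = [t, t'] \<and> v = [t', t])"
begin

abbreviation "X \<equiv> Y \<union> T"
abbreviation "M \<equiv> presented_monoid X R"
abbreviation "cls w \<equiv> word_cong X R `` {w}"

sublocale monoid M
  by (rule monoid_presented_monoid)

lemma cls_closed [simp]: "w \<in> lists X \<Longrightarrow> cls w \<in> carrier M"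
  by (simp add: presented_monoid_def quotientI)

lemma cls_Nil: "cls [] = \<one>\<^bsub>M\<^esub>"
  by (simp add: presented_monoid_def)

lemma cls_append: "u \<in> lists X \<Longrightarrow> v \<in> lists X \<Longrightarrow> cls (u @ v) = cls u \<otimes>\<^bsub>M\<^esub> cls v"
  by (simp add: presented_monoid_mult_class)

lemma cls_Cons: "x \<in> X \<Longrightarrow> w \<in> lists X \<Longrightarrow> cls (x # w) = cls [x] \<otimes>\<^bsub>M\<^esub> cls w"
  using cls_append[of "[x]" w] by simp

lemma cls_eq_iff: "u \<in> lists X \<Longrightarrow> v \<in> lists X \<Longrightarrow> cls u = cls v \<longleftrightarrow> (u, v) \<in> word_cong X R"
  by (rule eq_equiv_class_iff[OF equiv_word_cong])

lemma cls_rel: "(u, v) \<in> R \<Longrightarrow> u \<in> lists X \<Longrightarrow> v \<in> lists X \<Longrightarrow> cls u = cls v"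
  using word_cong.rel[of u v R X "[]" "[]"] by (simp add: cls_eq_iff)

section \<open>Unit part and conjugates of a word\<close>

definition unit_part :: "'x \<Rightarrow> 'x list set" where
  "unit_part x = (if x \<in> Y then cls [x] else \<one>\<^bsub>M\<^esub>)"

definition unit_prod :: "'x list \<Rightarrow> 'x list set" where
  "unit_prod w = list_prod (map unit_part w)"

text \<open>Moving all units of \<open>w\<close> to the right turns the letters from \<open>T\<close> into these conjugates.\<close>

fun conjugates :: "'x list \<Rightarrow> 'x list set list" where
  "conjugates [] = []"
| "conjugates (x # w) =
     (if x \<in> Y then map (conjugate (cls [x])) (conjugates w) else cls [x] # conjugates w)"

definition perm where
  "perm x = act (unit_part x) (conjugates [x])"

lemma unit_part_Units [simp]: "unit_part x \<in> Units M"
  by (simp add: unit_part_def units)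

lemma unit_prod_simps [simp]:
  "unit_prod [] = \<one>\<^bsub>M\<^esub>" "unit_prod (x # w) = unit_part x \<otimes>\<^bsub>M\<^esub> unit_prod w"
  by (simp_all add: unit_prod_def)

lemma unit_prod_Units [simp]: "unit_prod w \<in> Units M"
  by (induction w) auto

lemma conjugates_closed: "w \<in> lists X \<Longrightarrow> set (conjugates w) \<subseteq> carrier M"
  by (induction w) (auto simp: units)

lemma perm_closed: "perm x \<in> carrier (BijGroup points)"
  by (simp add: perm_def BijGroup_def act_Bij)

text \<open>For a unit \<open>g\<close>, \<open>g p h = (g p g^-1) (g h)\<close>: prepending a unit
  conjugates the whole product of conjugates, and prepending a letter of \<open>T\<close> merely
  extends the list.\<close>

lemma cls_decompose:
  "w \<in> lists X \<Longrightarrow> cls w = list_prod (conjugates w) \<otimes>\<^bsub>M\<^esub> unit_prod w"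
proof (induction w)
  case Nil
  then show ?case by (simp add: cls_Nil)
next
  case (Cons x w)
  have w: "w \<in> lists X" and x: "x \<in> X" using Cons.prems by auto
  note cl = conjugates_closed[OF w] Units_closed[OF unit_prod_Units[of w]]
  have "cls (x # w) = cls [x] \<otimes>\<^bsub>M\<^esub> (list_prod (conjugates w) \<otimes>\<^bsub>M\<^esub> unit_prod w)"
    using cls_Cons[OF x w] Cons.IH[OF w] by simp
  also have "\<dots> = list_prod (conjugates (x # w)) \<otimes>\<^bsub>M\<^esub> unit_prod (x # w)"
  proof (cases "x \<in> Y")
    case True
    have "list_prod (conjugates (x # w)) \<otimes>\<^bsub>M\<^esub> unit_prod (x # w)
        = conjugate (cls [x]) (list_prod (conjugates w)) \<otimes>\<^bsub>M\<^esub> cls [x] \<otimes>\<^bsub>M\<^esub> unit_prod w"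
      using True cl units[OF True]
      by (simp add: list_prod_map_conj unit_part_def m_assoc Units_closed)
    then show ?thesis using True cl units[OF True] x
      by (simp add: conjugate_mult_right m_assoc)
  next
    case False
    then show ?thesis using x cl by (simp add: unit_part_def m_assoc)
  qed
  finally show ?case .
qed

text \<open>The recursions of \<open>unit_prod\<close> and \<open>conjugates\<close> are the
  semidirect multiplication law of \<open>act\<close>, applied letter by letter.\<close>

lemma list_prod_perm:
  assumes "w \<in> lists X"
  shows "monoid.list_prod (BijGroup points) (map perm w) = act (unit_prod w) (conjugates w)"
proof -
  interpret B: group "BijGroup points" by (rule group_BijGroup)
  show ?thesis using assms
  proof (induction w)
    case Nil
    then show ?case by (simp add: act_one)
  next
    case (Cons x w)
    have w: "w \<in> lists X" and x: "x \<in> X" using Cons.hyps by auto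
    \<comment> \<open>This gives one formula for both kinds of letters: a letter outside
      \<open>Y\<close> has unit part \<open>\<one>\<close>, which leaves the conjugates
      unchanged.\<close>
    have 1: "map (conjugate \<one>\<^bsub>M\<^esub>) (conjugates w) = conjugates w"
      using conjugates_closed[OF w] by (induction "conjugates w") (auto intro!: map_idI)
    have "B.list_prod (map perm (x # w))
        = act (unit_part x) (conjugates [x])
            \<otimes>\<^bsub>BijGroup points\<^esub> act (unit_prod w) (conjugates w)"
      using Cons.IH by (simp add: perm_def[of x])
    also have "\<dots> = act (unit_prod (x # w))
        (conjugates [x] @ map (conjugate (unit_part x)) (conjugates w))"
      using act_mult conjugates_closed[of "[x]"] conjugates_closed[OF w] x
      by (simp del: conjugates.simps)
    also have "conjugates [x] @ map (conjugate (unit_part x)) (conjugates w) = conjugates (x # w)"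
      using 1 by (simp add: unit_part_def)
    finally show ?case .
  qed
qed

section \<open>Compatibility with the defining relations\<close>

lemma conjugates_lists_Y: "w \<in> lists Y \<Longrightarrow> conjugates w = []"
  by (induction w) auto

lemma unit_prod_lists_Y: "w \<in> lists Y \<Longrightarrow> unit_prod w = cls w"
  using cls_decompose[of w] by (auto simp: conjugates_lists_Y Units_closed)

lemma conjugates_append:
  assumes "u \<in> lists Y" "t \<in> T"
  shows "conjugates (u @ [t]) = [conjugate (cls u) (cls [t])]"
  using assms(1)
proof (induction u)
  case Nil
  then show ?case using assms disjoint by (auto simp: cls_Nil)
next
  case (Cons x u)
  then have "x \<in> Y" "u \<in> lists Y" by auto
  moreover from this have "u \<in> lists X" by auto
  ultimately show ?case
    using Cons.IH assms cls_Cons[of x u] units unit_prod_Units[of u]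
    by (simp add: unit_prod_lists_Y conjugate_conj)
qed

lemma unit_prod_append: "unit_prod (u @ v) = unit_prod u \<otimes>\<^bsub>M\<^esub> unit_prod v"
  by (induction u) (auto simp: Units_closed m_assoc)

text \<open>Each relation holds in \<open>M\<close>. For words in \<open>Y\<close> this gives equal
  units; \<open>a t = t' a\<close> says that conjugating \<open>t\<close> by \<open>a\<close> gives
  \<open>t'\<close>, so the lists coincide; in the last shape they differ by a swap, and dilations
  of commuting elements commute.\<close>

lemma perm_rels:
  assumes uv: "(u, v) \<in> R" "u \<in> lists X" "v \<in> lists X"
  shows "act (unit_prod u) (conjugates u) = act (unit_prod v) (conjugates v)"
proof -
  have T: "unit_part t = \<one>\<^bsub>M\<^esub>" "t \<notin> Y" if "t \<in> T" for t
    using that disjoint by (auto simp: unit_part_def)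
  note eq = cls_rel[OF uv]
  from rels[OF uv(1)] show ?thesis
  proof (elim disjE conjE bexE)
    assume "u \<in> lists Y" "v \<in> lists Y"
    then show ?thesis using eq by (simp add: conjugates_lists_Y unit_prod_lists_Y)
  next
    fix a t t' assume a: "a \<in> lists Y" and t: "t \<in> T" "t' \<in> T" and u: "u = a @ [t]" and v: "v = t' # a"
    have aX: "a \<in> lists X" using a by auto
    have aU: "cls a \<in> Units M" using unit_prod_Units[of a] a by (simp add: unit_prod_lists_Y)
    have "cls a \<otimes>\<^bsub>M\<^esub> cls [t] = cls [t'] \<otimes>\<^bsub>M\<^esub> cls a"
      using eq cls_append[OF aX, of "[t]"] cls_Cons[OF _ aX, of t'] t u v by simp
    then have "conjugate (cls a) (cls [t]) = cls [t']"
      using t aU by (simp add: conjugate_def m_assoc Units_closed)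
    then show ?thesis
      using a t aU by (simp add: u v conjugates_append unit_prod_append T conjugates_lists_Y
          unit_prod_lists_Y Units_closed)
  next
    fix t t' assume t: "t \<in> T" "t' \<in> T" and u: "u = [t, t']" and v: "v = [t', t]"
    have "cls [t] \<otimes>\<^bsub>M\<^esub> cls [t'] = cls [t'] \<otimes>\<^bsub>M\<^esub> cls [t]"
      using eq cls_Cons[of t "[t']"] cls_Cons[of t' "[t]"] t u v by simp
    then show ?thesis
      using t by (simp add: u v T) (rule act_eqI, simp add: dil_commute)
  qed
qed

theorem embeds_in_group: "embeds_in_group M"
proof (rule embeds_in_groupI)
  interpret B: group "BijGroup points" by (rule group_BijGroup)
  show "group (BijGroup points)" by (rule B.is_group)
  show perm: "perm \<in> X \<rightarrow> carrier (BijGroup points)" using perm_closed by auto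
  fix u v assume uv: "u \<in> lists X" "v \<in> lists X"
  show "(u, v) \<in> word_cong X R \<longleftrightarrow> B.list_prod (map perm u) = B.list_prod (map perm v)"
  proof
    assume "(u, v) \<in> word_cong X R"
    then show "B.list_prod (map perm u) = B.list_prod (map perm v)"
      using perm by (rule B.list_prod_word_cong) (simp add: list_prod_perm perm_rels)
  next
    \<comment> \<open>Injectivity of \<open>act\<close> returns the unit and the product of
      conjugates, from which \<open>cls_decompose\<close> rebuilds the class of the word.\<close>
    assume "B.list_prod (map perm u) = B.list_prod (map perm v)"
    then have "unit_prod u = unit_prod v \<and> list_prod (conjugates u) = list_prod (conjugates v)"
      using uv by (intro act_inject) (simp_all add: list_prod_perm conjugates_closed)
    then show "(u, v) \<in> word_cong X R"
      using uv cls_decompose by (simp flip: cls_eq_iff)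
  qed
qed

end

section \<open>Singular Artin monoids\<close>

lemma alt_word_in_lists: "a \<in> A \<Longrightarrow> b \<in> A \<Longrightarrow> alt_word n a b \<in> lists A"
  by (induction n arbitrary: a b) auto

lemma presented_monoid_UnitsI:
  assumes "([x, y], []) \<in> R" "([y, x], []) \<in> R" "x \<in> X" "y \<in> X"
  shows "word_cong X R `` {[x]} \<in> Units (presented_monoid X R)"
proof -
  let ?M = "presented_monoid X R"
  have "word_cong X R `` {[a]} \<otimes>\<^bsub>?M\<^esub> word_cong X R `` {[b]} = \<one>\<^bsub>?M\<^esub>"
    if "([a, b], []) \<in> R" "a \<in> X" "b \<in> X" for a b
  proof -
    have "([a, b], []) \<in> word_cong X R"
      using word_cong.rel[OF that(1), of X "[]" "[]"] that by simp
    then have "word_cong X R `` {[a, b]} = word_cong X R `` {[]}"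
      by (rule equiv_class_eq[OF equiv_word_cong])
    then show ?thesis
      using presented_monoid_mult_class[of "[a]" X "[b]" R] that
      by (simp add: presented_monoid_def)
  qed
  moreover have "word_cong X R `` {[a]} \<in> carrier ?M" if "a \<in> X" for a
    using that by (simp add: presented_monoid_def quotientI)
  ultimately show ?thesis using assms unfolding Units_def by blast
qed

text \<open>\<open>tau_braid\<close> is a conjugation relation with \<open>a\<close> the alternating
  word of length \<open>k - 1\<close>, and \<open>sigma_tau\<close> is one with
  \<open>a = [Sigma s]\<close> and \<open>t = t'\<close>. The inverse and braid relations involve
  only units, and \<open>tau_tau\<close> is a commutation.\<close>

lemma conjugation_presentation_sa:
  "conjugation_presentation (Sigma ` S \<union> SigmaInv ` S) (Tau ` S) (sa_rels S m)"
proof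
  show "(Sigma ` S \<union> SigmaInv ` S) \<inter> Tau ` S = {}" by auto
next
  fix y assume "y \<in> Sigma ` S \<union> SigmaInv ` S"
  then obtain s where "s \<in> S" "y = Sigma s \<or> y = SigmaInv s" by auto
  then show "word_cong (Sigma ` S \<union> SigmaInv ` S \<union> Tau ` S) (sa_rels S m) `` {[y]}
      \<in> Units (presented_monoid (Sigma ` S \<union> SigmaInv ` S \<union> Tau ` S) (sa_rels S m))"
    by (auto intro: presented_monoid_UnitsI sa_rels.inv_right sa_rels.inv_left)
next
  fix u v assume "(u, v) \<in> sa_rels S m"
  then show "u \<in> lists (Sigma ` S \<union> SigmaInv ` S) \<and> v \<in> lists (Sigma ` S \<union> SigmaInv ` S) \<or>
      (\<exists>a\<in>lists (Sigma ` S \<union> SigmaInv ` S). \<exists>t\<in>Tau ` S. \<exists>t'\<in>Tau ` S. u = a @ [t] \<and> v = t' # a) \<or>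
      (\<exists>t\<in>Tau ` S. \<exists>t'\<in>Tau ` S. u = [t, t'] \<and> v = [t', t])"
  proof cases
    case (sigma_tau s)
    then show ?thesis by (intro disjI2 disjI1 bexI[of _ "[Sigma s]"]) auto
  next
    case (braid s t k)
    then show ?thesis by (intro disjI1) (simp add: alt_word_in_lists)
  next
    case (tau_braid s t k)
    define a where "a = alt_word (k - 1) (Sigma s) (Sigma t)"
    have "a \<in> lists (Sigma ` S \<union> SigmaInv ` S)"
      using tau_braid unfolding a_def by (intro alt_word_in_lists) auto
    moreover have "u = a @ [Tau s]" "v = Tau (if even k then s else t) # a"
      using tau_braid by (simp_all add: a_def)
    moreover have "Tau s \<in> Tau ` S" "Tau (if even k then s else t) \<in> Tau ` S"
      using tau_braid by auto
    ultimately show ?thesis by blast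
  qed auto
qed

theorem corollary2p2:
  fixes S :: "'s set" and m :: "'s \<Rightarrow> 's \<Rightarrow> enat"
  assumes "finite S" and "coxeter_matrix S m"
  shows "embeds_in_group (singular_artin_monoid S m)"
  using conjugation_presentation.embeds_in_group[OF conjugation_presentation_sa]
  by (simp add: singular_artin_monoid_def sa_gens_def)

end
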